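(* If $D$ is a blocking odd cycle, then $D$ does not satisfy the BE-property.
   Context: Digraphs have no loops and no parallel arcs, but may contain both arcs $uv$ and $vu$ (cycles of length two). Two vertices $u,v$ are adjacent if $uv$ or $vu$ is an arc. $U(D)$ is the simple graph on $V(D)$ whose edges are the pairs of vertices adjacent in $D$. A source is a vertex with no in-neighbor, a sink is a vertex with no out-neighbor. A digraph $C$ is a blocking odd cycle if $U(C)$ is a cycle $x_1x_2\cdots x_{2k+1}x_1$ for some integer $k\ge 1$, and each of $x_1$ and $x_2$ is either a source or a sink in $C$. A stable set is a set of pairwise non-adjacent vertices; it is maximum if no stable set has larger cardinality. A path of $D$ is a directed path, i.e. a sequence $v_1v_2\cdots v_\ell$ of distinct vertices ($\ell\ge 1$) with $v_iv_{i+1}\in A(D)$ for $1\le i<\ell$. A path partition of $D$ is a collection of paths whose vertex sets partition $V(D)$. For a stable set $S$, an $S_{\rm BE}$-path partition of $D$ is a path partition $\mathcal P$ such that every $P=x_1x_2\cdots x_k\in\mathcal P$ satisfies $V(P)\cap S=\{x\}$ with $x\in\{x_1,x_k\}$. A digraph satisfies the BE-property if it has an $S_{\rm BE}$-path partition for every maximum stable set $S$. *)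

theory Defs
  imports
    "Graph_Theory.Digraph_Component"
    "Graph_Theory.Vertex_Walk"
    "HOL-Library.Disjoint_Sets"
begin

definition adjacent :: "('a, 'b) pre_digraph \<Rightarrow> 'a \<Rightarrow> 'a \<Rightarrow> bool" where
  "adjacent D u v \<longleftrightarrow> u \<rightarrow>\<^bsub>D\<^esub> v \<or> v \<rightarrow>\<^bsub>D\<^esub> u"

definition source :: "('a, 'b) pre_digraph \<Rightarrow> 'a \<Rightarrow> bool" where
  "source D v \<longleftrightarrow> v \<in> verts D \<and> \<not> (\<exists>u. u \<rightarrow>\<^bsub>D\<^esub> v)"

definition sink :: "('a, 'b) pre_digraph \<Rightarrow> 'a \<Rightarrow> bool" where
  "sink D v \<longleftrightarrow> v \<in> verts D \<and> \<not> (\<exists>u. v \<rightarrow>\<^bsub>D\<^esub> u)"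

text \<open>
  Following Graph_Theory, simple graphs are symmetric digraphs; the underlying graph $U(D)$ is
  \<^const>\<open>mk_symmetric\<close>. The predicate below says that the whole graph \<open>G\<close> is the
  cycle that visits the vertices of \<open>xs\<close> in this order and then returns to the first one;
  in particular \<open>G\<close> has no chords and no further vertices.
\<close>

definition is_cycle_graph :: "('a, 'b) pre_digraph \<Rightarrow> 'a list \<Rightarrow> bool" where
  "is_cycle_graph G xs \<longleftrightarrow>
     length xs \<ge> 3 \<and> distinct xs \<and> verts G = set xs \<and>
     (\<forall>u v. u \<rightarrow>\<^bsub>G\<^esub> v \<longleftrightarrow>
        (\<exists>i<length xs. {u, v} = {xs ! i, xs ! (Suc i mod length xs)}))"

text \<open>The vertices $x_1, x_2$ of the cycle are \<open>xs ! 0\<close> and \<open>xs ! 1\<close>.\<close>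

definition blocking_odd_cycle :: "('a, 'b) pre_digraph \<Rightarrow> bool" where
  "blocking_odd_cycle C \<longleftrightarrow>
     (\<exists>k xs. k \<ge> 1 \<and> length xs = 2 * k + 1 \<and>
        is_cycle_graph (with_proj (mk_symmetric C)) xs \<and>
        (source C (xs ! 0) \<or> sink C (xs ! 0)) \<and>
        (source C (xs ! 1) \<or> sink C (xs ! 1)))"

definition stable_set :: "('a, 'b) pre_digraph \<Rightarrow> 'a set \<Rightarrow> bool" where
  "stable_set D S \<longleftrightarrow> S \<subseteq> verts D \<and> pairwise (\<lambda>u v. \<not> adjacent D u v) S"

definition maximum_stable_set :: "('a, 'b) pre_digraph \<Rightarrow> 'a set \<Rightarrow> bool" where
  "maximum_stable_set D S \<longleftrightarrow>
     stable_set D S \<and> (\<forall>T. stable_set D T \<longrightarrow> card T \<le> card S)"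

text \<open>
  Paths are the non-empty vertex lists satisfying \<^const>\<open>vpath\<close>. Indexing the disjoint family
  by the paths themselves also excludes two different paths on the same vertex set.
\<close>

definition path_partition :: "('a, 'b) pre_digraph \<Rightarrow> 'a list set \<Rightarrow> bool" where
  "path_partition D \<P> \<longleftrightarrow>
     (\<forall>p\<in>\<P>. vpath p D) \<and> disjoint_family_on set \<P> \<and> (\<Union>p\<in>\<P>. set p) = verts D"

definition BE_path_partition :: "('a, 'b) pre_digraph \<Rightarrow> 'a set \<Rightarrow> 'a list set \<Rightarrow> bool" where
  "BE_path_partition D S \<P> \<longleftrightarrow>
     path_partition D \<P> \<and> (\<forall>p\<in>\<P>. \<exists>x\<in>{hd p, last p}. set p \<inter> S = {x})"

definition BE_property :: "('a, 'b) pre_digraph \<Rightarrow> bool" where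
  "BE_property D \<longleftrightarrow>
     (\<forall>S. maximum_stable_set D S \<longrightarrow> (\<exists>\<P>. BE_path_partition D S \<P>))"

end

theory Submission
  imports Defs
begin

text \<open>
  Let the underlying cycle be \<open>xs\<close>, with \<open>2 * k + 1\<close> vertices, and suppose that \<open>xs ! 0\<close> and
  \<open>xs ! 1\<close> are sources or sinks. Shifting a stable set by one step along the cycle makes it disjoint
  from itself, so a stable set has at most \<open>k\<close> vertices; hence the \<open>k\<close> vertices
  \<open>xs ! 2, xs ! 4, \<dots>, xs ! (2 * k)\<close> form a maximum stable set \<open>S\<close>. The only edge of the cycle that
  avoids \<open>S\<close> is the one joining \<open>xs ! 0\<close> and \<open>xs ! 1\<close>.

  For this \<open>S\<close> no path partition of the required kind exists, by counting. A path that meets \<open>S\<close> in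
  just one of its ends and has three or more vertices contains two consecutive vertices outside
  \<open>S\<close>, one of which is an inner vertex of the path. Those two vertices are \<open>xs ! 0\<close> and \<open>xs ! 1\<close>,
  but an inner vertex of a path has both an in-neighbour and an out-neighbour, so it is neither a
  source nor a sink. Thus every path of the partition has at most two vertices. As distinct paths
  meet \<open>S\<close> in distinct vertices, there are at most \<open>k\<close> of them, and they cover at most \<open>2 * k\<close>
  vertices.
\<close>

text \<open>
  If the path had three or more vertices, read it from its end in \<open>S\<close>: the second and third vertices are
  adjacent and avoid \<open>S\<close>, and the second has a neighbour on the path on either side.
\<close>

lemma BE_path_length_le_2:
  assumes path: "vpath p D"
    and x: "x \<in> {hd p, last p}" "set p \<inter> S = {x}"
    and blocked: "\<And>u v. \<lbrakk>u \<notin> S; v \<notin> S; adjacent D u v\<rbrakk> \<Longrightarrow> source D u \<or> sink D u"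
  shows "length p \<le> 2"
proof (rule ccontr)
  assume long: "\<not> length p \<le> 2"
  have arcs: "set (vwalk_arcs p) \<subseteq> arcs_ends D" and "distinct p"
    using path by (auto simp: vpath_def vwalk_def)
  from x(1) consider "x = hd p" | "x = last p" by auto
  then show False
  proof cases
    case 1
    obtain a b r where p: "p = x # a # b # r"
      using long 1 by (cases p rule: vwalk_arcs.cases; cases "tl (tl p)") auto
    have "a \<notin> S" "b \<notin> S" "x \<rightarrow>\<^bsub>D\<^esub> a" "a \<rightarrow>\<^bsub>D\<^esub> b"
      using x(2) \<open>distinct p\<close> arcs by (auto simp: p)
    then show False using blocked[of a b] by (auto simp: adjacent_def source_def sink_def)
  next
    case 2
    have "hd (rev p) = x" "\<not> length (rev p) \<le> 2"
      using long 2 by (auto simp: hd_rev)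
    then obtain a b r where "rev p = x # a # b # r"
      by (cases "rev p" rule: vwalk_arcs.cases; cases "tl (tl (rev p))") auto
    then have p: "p = rev r @ [b, a, x]" by (simp add: rev_swap)
    have "a \<notin> S" "b \<notin> S"
      using x(2) \<open>distinct p\<close> by (auto simp: p)
    moreover have "b \<rightarrow>\<^bsub>D\<^esub> a" "a \<rightarrow>\<^bsub>D\<^esub> x"
      using arcs set_vwalk_arcs_append2[of "[b, a, x]" "rev r"] by (auto simp: p)
    ultimately show False using blocked[of a b] by (auto simp: adjacent_def source_def sink_def)
  qed
qed

text \<open>
  Each path of the partition is determined by its vertex in \<open>S\<close>, so the at most two-element vertex
  sets of the paths can be indexed by \<open>S\<close>.
\<close>

lemma BE_path_partition_card_le:
  assumes part: "BE_path_partition D S \<P>" and S: "finite S" "S \<subseteq> verts D"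
    and blocked: "\<And>u v. \<lbrakk>u \<notin> S; v \<notin> S; adjacent D u v\<rbrakk> \<Longrightarrow> source D u \<or> sink D u"
  shows "card (verts D) \<le> 2 * card S"
proof -
  have disj: "disjoint_family_on set \<P>" and cover: "(\<Union>p\<in>\<P>. set p) = verts D"
    using part by (auto simp: BE_path_partition_def path_partition_def)
  have path: "vpath p D" and BE: "\<exists>x\<in>{hd p, last p}. set p \<inter> S = {x}" if "p \<in> \<P>" for p
    using part that unfolding BE_path_partition_def path_partition_def by blast+
  have "\<forall>s\<in>S. \<exists>p\<in>\<P>. s \<in> set p"
    using S(2) cover by blast
  then obtain f where f: "\<And>s. s \<in> S \<Longrightarrow> f s \<in> \<P> \<and> s \<in> set (f s)" by metis
  have "set p \<subseteq> (\<Union>s\<in>S. set (f s))" if p: "p \<in> \<P>" for p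
  proof -
    obtain s where s: "s \<in> set p" "s \<in> S" using BE[OF p] by blast
    with f[OF s(2)] disj p have "f s = p" by (auto simp: disjoint_family_on_def)
    with s(2) show ?thesis by blast
  qed
  then have "verts D \<subseteq> (\<Union>s\<in>S. set (f s))"
    unfolding cover[symmetric] by (rule UN_least)
  then have "card (verts D) \<le> card (\<Union>s\<in>S. set (f s))" using S(1) by (intro card_mono) auto
  also have "\<dots> \<le> (\<Sum>s\<in>S. card (set (f s)))" using S(1) by (rule card_UN_le)
  also have "\<dots> \<le> (\<Sum>s\<in>S. 2)"
  proof (rule sum_mono)
    fix s assume "s \<in> S"
    then have fs: "f s \<in> \<P>" using f by blast
    then obtain x where "x \<in> {hd (f s), last (f s)}" "set (f s) \<inter> S = {x}" using BE by blast
    with path[OF fs] have "length (f s) \<le> 2" using blocked by (rule BE_path_length_le_2)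
    then show "card (set (f s)) \<le> 2" using card_length le_trans by blast
  qed
  finally show ?thesis by simp
qed

lemma dominates_underlying_iff:
  "u \<rightarrow>\<^bsub>with_proj (mk_symmetric D)\<^esub> v \<longleftrightarrow> adjacent D u v"
  by (auto simp: adjacent_def parcs_mk_symmetric arcs_ends_conv)

text \<open>A stable set and its shift by one position along the cycle are disjoint.\<close>

lemma stable_set_cycle_card_le:
  assumes dist: "distinct xs" and verts: "verts D = set xs"
    and adj: "\<And>i. i < length xs \<Longrightarrow> adjacent D (xs ! i) (xs ! (Suc i mod length xs))"
    and two: "2 \<le> length xs"
    and T: "stable_set D T"
  shows "2 * card T \<le> length xs"
proof -
  define n where "n = length xs"
  define I where "I = {i. i < n \<and> xs ! i \<in> T}"
  define J where "J = (\<lambda>i. Suc i mod n) ` I"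
  have n: "n \<ge> 2" using two by (simp add: n_def)
  have fin: "finite I" by (simp add: I_def)
  have "T = (!) xs ` I"
    using T by (auto simp: I_def n_def stable_set_def verts in_set_conv_nth subset_iff image_iff)
  then have "card T \<le> card I" using fin by (simp add: card_image_le)
  moreover have "inj_on (\<lambda>i. Suc i mod n) I"
    using n by (auto simp: inj_on_def I_def mod_Suc split: if_splits)
  then have "card J = card I" unfolding J_def by (rule card_image)
  moreover have "I \<inter> J = {}"
  proof -
    have "xs ! (Suc i mod n) \<notin> T" if i: "i \<in> I" for i
    proof
      assume s: "xs ! (Suc i mod n) \<in> T"
      have "i < n" "xs ! i \<in> T" using i by (auto simp: I_def)
      moreover have "i \<noteq> Suc i mod n" using n \<open>i < n\<close> by (auto simp: mod_Suc)
      moreover have "Suc i mod n < n" using n by simp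
      ultimately have "xs ! i \<noteq> xs ! (Suc i mod n)"
        using dist by (simp add: n_def nth_eq_iff_index_eq)
      with T s \<open>xs ! i \<in> T\<close> adj[of i] \<open>i < n\<close> show False
        by (auto simp: stable_set_def pairwise_def n_def)
    qed
    then show ?thesis by (auto simp: J_def I_def)
  qed
  moreover have "card (I \<union> J) \<le> card {..<n}"
    using n by (intro card_mono) (auto simp: I_def J_def)
  ultimately show ?thesis using fin by (simp add: card_Un_disjoint J_def n_def)
qed

theorem proposition1p4:
  fixes D :: "('a, 'b) pre_digraph"
  assumes "digraph D"
    and "blocking_odd_cycle D"
  shows "\<not> BE_property D"
proof
  assume BE: "BE_property D"
  obtain k xs where k: "k \<ge> 1" and len: "length xs = 2 * k + 1"
    and cyc: "is_cycle_graph (with_proj (mk_symmetric D)) xs"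
    and ends: "source D (xs ! 0) \<or> sink D (xs ! 0)" "source D (xs ! 1) \<or> sink D (xs ! 1)"
    using assms(2) by (auto simp: blocking_odd_cycle_def)
  have dist: "distinct xs" and verts: "verts D = set xs"
    and adj: "\<And>u v. adjacent D u v \<longleftrightarrow>
      (\<exists>i<length xs. {u, v} = {xs ! i, xs ! (Suc i mod length xs)})"
    using cyc unfolding is_cycle_graph_def dominates_underlying_iff by simp_all
  define S where "S = (\<lambda>j. xs ! (2 * j)) ` {1..k}"
  have "inj_on (\<lambda>j. xs ! (2 * j)) {1..k}"
    using dist len by (auto simp: inj_on_def nth_eq_iff_index_eq)
  then have cardS: "card S = k" by (simp add: S_def card_image)
  have S_sub: "S \<subseteq> verts D" using len by (auto simp: S_def verts)
  have in_S: "xs ! i \<in> S \<longleftrightarrow> even i \<and> i \<noteq> 0" if "i < length xs" for i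
    using that dist len by (auto simp: S_def nth_eq_iff_index_eq image_iff elim!: evenE)
  \<comment> \<open>Around the odd cycle membership in \<open>S\<close> alternates, except across the edge from position 0
    to position 1.\<close>
  have alternate: "xs ! i \<in> S \<longleftrightarrow> xs ! (Suc i mod length xs) \<notin> S" if "i < length xs" "i \<noteq> 0" for i
  proof (cases "Suc i = length xs")
    case True
    then show ?thesis using in_S[of i] in_S[of 0] that len by auto
  next
    case False
    then show ?thesis using in_S[of i] in_S[of "Suc i"] that by auto
  qed
  have not_S: "xs ! 0 \<notin> S" "xs ! 1 \<notin> S"
    using in_S[of 0] in_S[of 1] len k by auto
  have edge: "(u \<in> S \<longleftrightarrow> v \<notin> S) \<or> {u, v} = {xs ! 0, xs ! 1}" if "adjacent D u v" for u v
  proof -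
    obtain i where i: "i < length xs" "{u, v} = {xs ! i, xs ! (Suc i mod length xs)}"
      using \<open>adjacent D u v\<close> adj by blast
    show ?thesis
    proof (cases "i = 0")
      case True
      then show ?thesis using i len k by simp
    next
      case False
      then show ?thesis using i alternate[of i] by (auto simp: doubleton_eq_iff)
    qed
  qed
  have "stable_set D S"
    using S_sub edge not_S by (auto simp: stable_set_def pairwise_def doubleton_eq_iff)
  moreover have "card T \<le> card S" if "stable_set D T" for T
    using stable_set_cycle_card_le[OF dist verts _ _ that] adj len k cardS by fastforce
  ultimately have "maximum_stable_set D S" by (simp add: maximum_stable_set_def)
  then obtain \<P> where "BE_path_partition D S \<P>" using BE by (auto simp: BE_property_def)
  moreover have "source D u \<or> sink D u" if "u \<notin> S" "v \<notin> S" "adjacent D u v" for u v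
    using edge[OF that(3)] that(1,2) ends by (auto simp: doubleton_eq_iff)
  ultimately have "card (verts D) \<le> 2 * card S"
    using S_sub by (intro BE_path_partition_card_le) (auto simp: S_def)
  then show False using cardS len dist by (simp add: verts distinct_card)
qed

end
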